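(* Let $\mathcal{T}_1$ and $\mathcal{T}_2$ be two sets of formulas in a logic $\mathcal{L}$, with $\mathrm{sig}(\mathcal{T}_1)\cap\mathrm{sig}(\mathcal{T}_2)=\Delta$ for a signature $\Delta$, which satisfy the following condition: $( * )$ for $i=1,2$, any model of $\mathcal{T}_i$ can be expanded to a model of $\mathcal{T}_1\cup\mathcal{T}_2$. Then: (a) $\mathcal{T}_1$ and $\mathcal{T}_2$ are $\Delta$-inseparable; (b) for $\sigma$ a signature or a ground atom, $\mathrm{forget}(\mathcal{T}_1,\sigma)$ and $\mathrm{forget}(\mathcal{T}_2,\sigma)$ satisfy $( * )$ as well: for $i=1,2$, any model of $\mathrm{forget}(\mathcal{T}_i,\sigma)$ can be expanded to a model of $\mathrm{forget}(\mathcal{T}_1,\sigma)\cup\mathrm{forget}(\mathcal{T}_2,\sigma)$.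
   Context: $\mathcal{L}$ is a (possibly many-sorted) logic that is a fragment (a set of sentences) of second-order logic with standard Tarskian semantics. A signature is a set of non-logical symbols (equality is logical); $\mathrm{sig}(\cdot)$ is the set of non-logical symbols occurring in a formula, term or set of formulas. Sets of formulas consist of sentences. For a structure $\mathcal{M}$ and a subset $\tau$ of its symbols, the reduct $\mathcal{M}|_\tau$ is the structure with the same domains and only the symbols of $\tau$, interpreted as in $\mathcal{M}$; $\mathcal{M}$ is then called an expansion of $\mathcal{M}|_\tau$. $\mathrm{Cons}(\mathcal{T},\Delta)=\{\varphi\in\mathcal{L}\mid\mathcal{T}\models\varphi,\ \mathrm{sig}(\varphi)\subseteq\Delta\}$; $\mathcal{T}_1,\mathcal{T}_2$ are $\Delta$-inseparable if $\mathrm{Cons}(\mathcal{T}_1,\Delta)=\mathrm{Cons}(\mathcal{T}_2,\Delta)$. Forgetting: let $\sigma$ be a signature or a ground atom. For structures $\mathcal{M},\mathcal{M}'$ write $\mathcal{M}\sim_\sigma\mathcal{M}'$ if they have the same domain for each sort; they interpret all symbols which do not occur in $\sigma$ identically; and, if $\sigma$ is a ground atom $P(\bar t)$, they agree on the interpretation $\bar u$ of $\bar t$ and for every vector of elements $\bar v\neq\bar u$, $\mathcal{M}\models P(\bar v)$ iff $\mathcal{M}'\models P(\bar v)$. $\mathrm{forget}(\mathcal{T},\sigma)$ denotes a set of formulas in a fragment of second-order logic such that for every structure $\mathcal{M}'$: $\mathcal{M}'\models\mathrm{forget}(\mathcal{T},\sigma)$ iff there is $\mathcal{M}\models\mathcal{T}$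 with $\mathcal{M}\sim_\sigma\mathcal{M}'$.
   Formalization: (b) is false as stated; added: forget(T_i,σ) has no symbols private to the other theory, and a ground atom's arguments have none either unless forgetting leaves T_i unchanged up to equivalence. Models in ( * ) are structures in exactly the theory's signature. *)

theory Defs
  imports "HOL-Library.FuncSet"
begin

text \<open>
  Many-sorted second-order logic with equality. \<open>'s\<close> is the type of sorts (the one-sorted case is
  \<open>'s = unit\<close>), \<open>'n\<close> the type of names of non-logical symbols, and \<open>'u\<close> a universe from which the
  elements of structures are drawn. A symbol carries its rank, so that no ambient arity
  function is needed; constants and propositional letters are symbols with no argument sorts.
\<close>

datatype ('s, 'n) fsym = FSym 'n (fargs: "'s list") (fres: 's)
datatype ('s, 'n) psym = PSym 'n (pargs: "'s list")

datatype ('s, 'n) sym = FS "('s, 'n) fsym" | PS "('s, 'n) psym"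

text \<open>Second-order variables are ranked like symbols, with natural numbers as names.\<close>

datatype ('s, 'n) trm =
    Var 's nat
  | Fun "('s, 'n) fsym" "('s, 'n) trm list"
  | FVar "('s, nat) fsym" "('s, 'n) trm list"

text \<open>The connectives and quantifiers not listed here are the usual classical abbreviations.\<close>

datatype ('s, 'n) fm =
    Eq "('s, 'n) trm" "('s, 'n) trm"
  | Pred "('s, 'n) psym" "('s, 'n) trm list"
  | PVar "('s, nat) psym" "('s, 'n) trm list"
  | Neg "('s, 'n) fm"
  | And "('s, 'n) fm" "('s, 'n) fm"
  | All 's nat "('s, 'n) fm"
  | AllF "('s, nat) fsym" "('s, 'n) fm"
  | AllP "('s, nat) psym" "('s, 'n) fm"

subsection \<open>Well-sortedness, sentences, occurring symbols\<close>

primrec sort_of :: "('s, 'n) trm \<Rightarrow> 's" where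
  "sort_of (Var s x) = s"
| "sort_of (Fun f ts) = fres f"
| "sort_of (FVar g ts) = fres g"

fun wf_trm :: "('s, 'n) trm \<Rightarrow> bool" where
  "wf_trm (Var s x) \<longleftrightarrow> True"
| "wf_trm (Fun f ts) \<longleftrightarrow> map sort_of ts = fargs f \<and> (\<forall>t \<in> set ts. wf_trm t)"
| "wf_trm (FVar g ts) \<longleftrightarrow> map sort_of ts = fargs g \<and> (\<forall>t \<in> set ts. wf_trm t)"

primrec wf_fm :: "('s, 'n) fm \<Rightarrow> bool" where
  "wf_fm (Eq t u) \<longleftrightarrow> wf_trm t \<and> wf_trm u \<and> sort_of t = sort_of u"
| "wf_fm (Pred p ts) \<longleftrightarrow> map sort_of ts = pargs p \<and> (\<forall>t \<in> set ts. wf_trm t)"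
| "wf_fm (PVar r ts) \<longleftrightarrow> map sort_of ts = pargs r \<and> (\<forall>t \<in> set ts. wf_trm t)"
| "wf_fm (Neg \<phi>) \<longleftrightarrow> wf_fm \<phi>"
| "wf_fm (And \<phi> \<psi>) \<longleftrightarrow> wf_fm \<phi> \<and> wf_fm \<psi>"
| "wf_fm (All s x \<phi>) \<longleftrightarrow> wf_fm \<phi>"
| "wf_fm (AllF g \<phi>) \<longleftrightarrow> wf_fm \<phi>"
| "wf_fm (AllP r \<phi>) \<longleftrightarrow> wf_fm \<phi>"

datatype 's var = V1 's nat | VF "('s, nat) fsym" | VP "('s, nat) psym"

fun fv_trm :: "('s, 'n) trm \<Rightarrow> 's var set" where
  "fv_trm (Var s x) = {V1 s x}"
| "fv_trm (Fun f ts) = (\<Union>t \<in> set ts. fv_trm t)"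
| "fv_trm (FVar g ts) = insert (VF g) (\<Union>t \<in> set ts. fv_trm t)"

primrec fv :: "('s, 'n) fm \<Rightarrow> 's var set" where
  "fv (Eq t u) = fv_trm t \<union> fv_trm u"
| "fv (Pred p ts) = (\<Union>t \<in> set ts. fv_trm t)"
| "fv (PVar r ts) = insert (VP r) (\<Union>t \<in> set ts. fv_trm t)"
| "fv (Neg \<phi>) = fv \<phi>"
| "fv (And \<phi> \<psi>) = fv \<phi> \<union> fv \<psi>"
| "fv (All s x \<phi>) = fv \<phi> - {V1 s x}"
| "fv (AllF g \<phi>) = fv \<phi> - {VF g}"
| "fv (AllP r \<phi>) = fv \<phi> - {VP r}"

definition sentence :: "('s, 'n) fm \<Rightarrow> bool" where
  "sentence \<phi> \<longleftrightarrow> wf_fm \<phi> \<and> fv \<phi> = {}"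

fun sig_trm :: "('s, 'n) trm \<Rightarrow> ('s, 'n) sym set" where
  "sig_trm (Var s x) = {}"
| "sig_trm (Fun f ts) = insert (FS f) (\<Union>t \<in> set ts. sig_trm t)"
| "sig_trm (FVar g ts) = (\<Union>t \<in> set ts. sig_trm t)"

primrec sig_fm :: "('s, 'n) fm \<Rightarrow> ('s, 'n) sym set" where
  "sig_fm (Eq t u) = sig_trm t \<union> sig_trm u"
| "sig_fm (Pred p ts) = insert (PS p) (\<Union>t \<in> set ts. sig_trm t)"
| "sig_fm (PVar r ts) = (\<Union>t \<in> set ts. sig_trm t)"
| "sig_fm (Neg \<phi>) = sig_fm \<phi>"
| "sig_fm (And \<phi> \<psi>) = sig_fm \<phi> \<union> sig_fm \<psi>"
| "sig_fm (All s x \<phi>) = sig_fm \<phi>"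
| "sig_fm (AllF g \<phi>) = sig_fm \<phi>"
| "sig_fm (AllP r \<phi>) = sig_fm \<phi>"

definition sig :: "('s, 'n) fm set \<Rightarrow> ('s, 'n) sym set" where
  "sig T = (\<Union>\<phi> \<in> T. sig_fm \<phi>)"

subsection \<open>Structures\<close>

text \<open>
  A structure interprets only the symbols in its vocabulary, hence the partial maps. Functions
  are taken to be extensional and relations to consist of tuples of the right sorts, so that
  equality of structures is equality of domains, vocabularies and interpretations.
\<close>

record ('s, 'n, 'u) struct =
  carr :: "'s \<Rightarrow> 'u set"
  funs :: "('s, 'n) fsym \<rightharpoonup> ('u list \<Rightarrow> 'u)"
  preds :: "('s, 'n) psym \<rightharpoonup> 'u list set"

definition tuples :: "('s, 'n, 'u) struct \<Rightarrow> 's list \<Rightarrow> 'u list set" where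
  "tuples M ss = {us. list_all2 (\<lambda>u s. u \<in> carr M s) us ss}"

definition "structure" :: "('s, 'n, 'u) struct \<Rightarrow> bool" where
  "structure M \<longleftrightarrow>
     (\<forall>s. carr M s \<noteq> {}) \<and>
     (\<forall>f h. funs M f = Some h \<longrightarrow> h \<in> tuples M (fargs f) \<rightarrow>\<^sub>E carr M (fres f)) \<and>
     (\<forall>p R. preds M p = Some R \<longrightarrow> R \<subseteq> tuples M (pargs p))"

definition vocab :: "('s, 'n, 'u) struct \<Rightarrow> ('s, 'n) sym set" where
  "vocab M = FS ` dom (funs M) \<union> PS ` dom (preds M)"

definition reduct :: "('s, 'n, 'u) struct \<Rightarrow> ('s, 'n) sym set \<Rightarrow> ('s, 'n, 'u) struct" where
  "reduct M \<tau> = \<lparr>carr = carr M,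
                 funs = funs M |` {f. FS f \<in> \<tau>},
                 preds = preds M |` {p. PS p \<in> \<tau>}\<rparr>"

definition expansion_of :: "('s, 'n, 'u) struct \<Rightarrow> ('s, 'n, 'u) struct \<Rightarrow> bool" where
  "expansion_of N M \<longleftrightarrow> (\<exists>\<tau> \<subseteq> vocab N. M = reduct N \<tau>)"

subsection \<open>Tarskian semantics\<close>

record ('s, 'u) asg =
  a1 :: "'s \<times> nat \<Rightarrow> 'u"
  aF :: "('s, nat) fsym \<Rightarrow> 'u list \<Rightarrow> 'u"
  aP :: "('s, nat) psym \<Rightarrow> 'u list set"

definition is_asg :: "('s, 'n, 'u) struct \<Rightarrow> ('s, 'u) asg \<Rightarrow> bool" where
  "is_asg M A \<longleftrightarrow>
     (\<forall>s x. a1 A (s, x) \<in> carr M s) \<and>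
     (\<forall>g. aF A g \<in> tuples M (fargs g) \<rightarrow>\<^sub>E carr M (fres g)) \<and>
     (\<forall>r. aP A r \<subseteq> tuples M (pargs r))"

fun eval :: "('s, 'n, 'u) struct \<Rightarrow> ('s, 'u) asg \<Rightarrow> ('s, 'n) trm \<Rightarrow> 'u" where
  "eval M A (Var s x) = a1 A (s, x)"
| "eval M A (Fun f ts) = the (funs M f) (map (eval M A) ts)"
| "eval M A (FVar g ts) = aF A g (map (eval M A) ts)"

primrec sat :: "('s, 'n, 'u) struct \<Rightarrow> ('s, 'u) asg \<Rightarrow> ('s, 'n) fm \<Rightarrow> bool" where
  "sat M A (Eq t u) \<longleftrightarrow> eval M A t = eval M A u"
| "sat M A (Pred p ts) \<longleftrightarrow> map (eval M A) ts \<in> the (preds M p)"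
| "sat M A (PVar r ts) \<longleftrightarrow> map (eval M A) ts \<in> aP A r"
| "sat M A (Neg \<phi>) \<longleftrightarrow> \<not> sat M A \<phi>"
| "sat M A (And \<phi> \<psi>) \<longleftrightarrow> sat M A \<phi> \<and> sat M A \<psi>"
| "sat M A (All s x \<phi>) \<longleftrightarrow>
     (\<forall>u \<in> carr M s. sat M (A\<lparr>a1 := (a1 A)((s, x) := u)\<rparr>) \<phi>)"
| "sat M A (AllF g \<phi>) \<longleftrightarrow>
     (\<forall>h \<in> tuples M (fargs g) \<rightarrow>\<^sub>E carr M (fres g). sat M (A\<lparr>aF := (aF A)(g := h)\<rparr>) \<phi>)"
| "sat M A (AllP r \<phi>) \<longleftrightarrow>
     (\<forall>R \<in> Pow (tuples M (pargs r)). sat M (A\<lparr>aP := (aP A)(r := R)\<rparr>) \<phi>)"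

definition model :: "('s, 'n, 'u) struct \<Rightarrow> ('s, 'n) fm set \<Rightarrow> bool" where
  "model M T \<longleftrightarrow>
     structure M \<and> sig T \<subseteq> vocab M \<and> (\<forall>\<phi> \<in> T. \<forall>A. is_asg M A \<longrightarrow> sat M A \<phi>)"

text \<open>
  The argument of type \<open>'u itself\<close> only names the universe over which the structures range: it
  cannot be inferred from sets of formulas.
\<close>

definition entails :: "'u itself \<Rightarrow> ('s, 'n) fm set \<Rightarrow> ('s, 'n) fm \<Rightarrow> bool" where
  "entails U T \<phi> \<longleftrightarrow>
     (\<forall>M :: ('s, 'n, 'u) struct. model M T \<and> sig_fm \<phi> \<subseteq> vocab M \<longrightarrow> model M {\<phi>})"

definition equivalent :: "'u itself \<Rightarrow> ('s, 'n) fm set \<Rightarrow> ('s, 'n) fm set \<Rightarrow> bool" where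
  "equivalent U T T' \<longleftrightarrow> (\<forall>\<phi> \<in> T'. entails U T \<phi>) \<and> (\<forall>\<phi> \<in> T. entails U T' \<phi>)"

definition Cons ::
  "'u itself \<Rightarrow> ('s, 'n) fm set \<Rightarrow> ('s, 'n) fm set \<Rightarrow> ('s, 'n) sym set \<Rightarrow> ('s, 'n) fm set" where
  "Cons U L T \<Delta> = {\<phi> \<in> L. entails U T \<phi> \<and> sig_fm \<phi> \<subseteq> \<Delta>}"

definition inseparable ::
  "'u itself \<Rightarrow> ('s, 'n) fm set \<Rightarrow> ('s, 'n) sym set \<Rightarrow>
   ('s, 'n) fm set \<Rightarrow> ('s, 'n) fm set \<Rightarrow> bool" where
  "inseparable U L \<Delta> T1 T2 \<longleftrightarrow> Cons U L T1 \<Delta> = Cons U L T2 \<Delta>"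

text \<open>
  A model that is to be expanded is a structure in exactly the vocabulary of the theory;
  otherwise it could already interpret, arbitrarily, symbols private to the other theory.
\<close>

definition mutually_expandable ::
  "'u itself \<Rightarrow> ('s, 'n) fm set \<Rightarrow> ('s, 'n) fm set \<Rightarrow> bool" where
  "mutually_expandable U T1 T2 \<longleftrightarrow>
     (\<forall>T \<in> {T1, T2}. \<forall>M :: ('s, 'n, 'u) struct. model M T \<and> vocab M = sig T \<longrightarrow>
        (\<exists>N. model N (T1 \<union> T2) \<and> expansion_of N M))"

subsection \<open>Forgetting\<close>

datatype ('s, 'n) target = Sig "('s, 'n) sym set" | Atom "('s, 'n) psym" "('s, 'n) trm list"

primrec wf_target :: "('s, 'n) target \<Rightarrow> bool" where
  "wf_target (Sig \<tau>) \<longleftrightarrow> True"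
| "wf_target (Atom p ts) \<longleftrightarrow> wf_fm (Pred p ts) \<and> fv (Pred p ts) = {}"

primrec target_sig :: "('s, 'n) target \<Rightarrow> ('s, 'n) sym set" where
  "target_sig (Sig \<tau>) = \<tau>"
| "target_sig (Atom p ts) = sig_fm (Pred p ts)"

text \<open>
  The symbols of the tuple \<open>ts\<close> of an atom \<open>p(ts)\<close>; none for a signature. Forgetting an atom whose
  arguments use symbols private to one of two theories need not preserve mutual expandability:
  for \<open>T1 = {\<exists>!x. A(x), \<forall>x. P(x) \<longleftrightarrow> A(x)}\<close> and \<open>T2 = {\<exists>!x. A(x), A(c)}\<close>, forgetting \<open>P(c)\<close> turns
  \<open>T1\<close> into \<open>{\<exists>!x. A(x), \<forall>x. x \<noteq> c \<longrightarrow> (P(x) \<longleftrightarrow> A(x))}\<close>, which has models violating \<open>A(c)\<close>.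
\<close>

primrec target_args :: "('s, 'n) target \<Rightarrow> ('s, 'n) sym set" where
  "target_args (Sig \<tau>) = {}"
| "target_args (Atom p ts) = (\<Union>t \<in> set ts. sig_trm t)"

text \<open>The value of a ground term does not depend on the assignment.\<close>

definition gvals :: "('s, 'n, 'u) struct \<Rightarrow> ('s, 'n) trm list \<Rightarrow> 'u list" where
  "gvals M ts = map (eval M undefined) ts"

primrec agree_off :: "('s, 'n) target \<Rightarrow> ('s, 'n, 'u) struct \<Rightarrow> ('s, 'n, 'u) struct \<Rightarrow> bool" where
  "agree_off (Sig \<tau>) M M' \<longleftrightarrow> True"
| "agree_off (Atom p ts) M M' \<longleftrightarrow>
     gvals M ts = gvals M' ts \<and>
     (\<forall>v \<in> tuples M (pargs p). v \<noteq> gvals M ts \<longrightarrow>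
        (v \<in> the (preds M p) \<longleftrightarrow> v \<in> the (preds M' p)))"

text \<open>
  All symbols of an atom, including those of its arguments, may be reinterpreted, as long as
  the tuple denoted by the arguments stays the same.
\<close>

definition sim :: "('s, 'n) target \<Rightarrow> ('s, 'n, 'u) struct \<Rightarrow> ('s, 'n, 'u) struct \<Rightarrow> bool" where
  "sim \<sigma> M M' \<longleftrightarrow>
     carr M = carr M' \<and> vocab M = vocab M' \<and>
     (\<forall>f. FS f \<notin> target_sig \<sigma> \<longrightarrow> funs M f = funs M' f) \<and>
     (\<forall>p. PS p \<notin> target_sig \<sigma> \<longrightarrow> preds M p = preds M' p) \<and>
     agree_off \<sigma> M M'"

text \<open>
  \<open>F\<close> is a result of forgetting \<open>\<sigma>\<close> in \<open>T\<close>. The structures considered are those that interpret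
  everything mentioned.
\<close>

definition is_forget ::
  "'u itself \<Rightarrow> ('s, 'n) fm set \<Rightarrow> ('s, 'n) target \<Rightarrow> ('s, 'n) fm set \<Rightarrow> bool" where
  "is_forget U T \<sigma> F \<longleftrightarrow>
     (\<forall>\<phi> \<in> F. sentence \<phi>) \<and>
     (\<forall>M' :: ('s, 'n, 'u) struct.
        structure M' \<and> sig T \<union> target_sig \<sigma> \<union> sig F \<subseteq> vocab M' \<longrightarrow>
        (model M' F \<longleftrightarrow> (\<exists>M. model M T \<and> sim \<sigma> M M')))"

end

theory Submission
  imports Defs
begin

text \<open>
  A model of \<open>F1\<close>, made to interpret every symbol, is similar to some model \<open>M\<close> of \<open>T1\<close>, and the
  reduct of \<open>M\<close> to the symbols of \<open>T1\<close> expands to a model \<open>N\<close> of both theories. Copying from \<open>N\<close> the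
  symbols private to \<open>T2\<close> turns \<open>M\<close> into a model of \<open>T2\<close>. The same copying applied to the model of
  \<open>F1\<close> does not disturb \<open>F1\<close> and preserves similarity, so its result is also a model of \<open>F2\<close>.
  For an atom, similarity is preserved because the arguments of the atom are not copied, or,
  if \<open>F1\<close> is equivalent to \<open>T1\<close>, because \<open>M\<close> can be taken to be the model of \<open>F1\<close> itself.
\<close>

section \<open>Agreement, patches and expansions of structures\<close>

definition agree_on ::
  "('s, 'n) sym set \<Rightarrow> ('s, 'n, 'u) struct \<Rightarrow> ('s, 'n, 'u) struct \<Rightarrow> bool" where
  "agree_on S M N \<longleftrightarrow>
     carr M = carr N \<and>
     (\<forall>f. FS f \<in> S \<longrightarrow> funs M f = funs N f) \<and>
     (\<forall>p. PS p \<in> S \<longrightarrow> preds M p = preds N p)"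

text \<open>Values on \<open>D\<close> come from \<open>N\<close> unconditionally: a symbol of
  \<open>D\<close> that \<open>N\<close> does not interpret is lost.\<close>

definition patch ::
  "('s, 'n) sym set \<Rightarrow> ('s, 'n, 'u) struct \<Rightarrow> ('s, 'n, 'u) struct \<Rightarrow> ('s, 'n, 'u) struct" where
  "patch D N M = \<lparr>carr = carr M,
                  funs = (\<lambda>f. if FS f \<in> D then funs N f else funs M f),
                  preds = (\<lambda>p. if PS p \<in> D then preds N p else preds M p)\<rparr>"

lemma carr_patch [simp]: "carr (patch D N M) = carr M"
  and funs_patch [simp]: "funs (patch D N M) f = (if FS f \<in> D then funs N f else funs M f)"
  and preds_patch [simp]: "preds (patch D N M) p = (if PS p \<in> D then preds N p else preds M p)"
  by (simp_all add: patch_def)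

lemma carr_reduct [simp]: "carr (reduct M \<tau>) = carr M"
  and funs_reduct [simp]: "funs (reduct M \<tau>) f = (if FS f \<in> \<tau> then funs M f else None)"
  and preds_reduct [simp]: "preds (reduct M \<tau>) p = (if PS p \<in> \<tau> then preds M p else None)"
  by (simp_all add: reduct_def restrict_map_def)

lemma FS_in_vocab [simp]: "FS f \<in> vocab M \<longleftrightarrow> funs M f \<noteq> None"
  and PS_in_vocab [simp]: "PS p \<in> vocab M \<longleftrightarrow> preds M p \<noteq> None"
  by (auto simp: vocab_def)

lemma vocab_subset_iff:
  "S \<subseteq> vocab M \<longleftrightarrow>
     (\<forall>f. FS f \<in> S \<longrightarrow> funs M f \<noteq> None) \<and> (\<forall>p. PS p \<in> S \<longrightarrow> preds M p \<noteq> None)"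
    (is "_ \<longleftrightarrow> ?R")
proof
  assume R: ?R
  show "S \<subseteq> vocab M"
  proof
    show "x \<in> vocab M" if "x \<in> S" for x
      using R that by (cases x) simp_all
  qed
qed (use FS_in_vocab PS_in_vocab in blast)

lemma vocab_reduct: "vocab (reduct M \<tau>) = vocab M \<inter> \<tau>"
proof (rule set_eqI)
  show "x \<in> vocab (reduct M \<tau>) \<longleftrightarrow> x \<in> vocab M \<inter> \<tau>" for x
    by (cases x) auto
qed

lemma vocab_patch: "vocab (patch D N M) = vocab N \<inter> D \<union> (vocab M - D)"
proof (rule set_eqI)
  show "x \<in> vocab (patch D N M) \<longleftrightarrow> x \<in> vocab N \<inter> D \<union> (vocab M - D)" for x
    by (cases x) auto
qed

lemma tuples_cong: "carr M = carr N \<Longrightarrow> tuples M ss = tuples N ss"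
  by (simp add: tuples_def)

lemma agree_on_sym: "agree_on S M N \<Longrightarrow> agree_on S N M"
  by (simp add: agree_on_def)

lemma agree_on_trans: "agree_on S M N \<Longrightarrow> agree_on S N K \<Longrightarrow> agree_on S M K"
  by (simp add: agree_on_def)

lemma agree_on_mono: "agree_on S M N \<Longrightarrow> S' \<subseteq> S \<Longrightarrow> agree_on S' M N"
  by (auto simp: agree_on_def)

lemma agree_on_Un: "agree_on (S \<union> S') M N \<longleftrightarrow> agree_on S M N \<and> agree_on S' M N"
  by (auto simp: agree_on_def)

lemma agree_on_reduct: "agree_on \<tau> M (reduct M \<tau>)"
  by (simp add: agree_on_def)

lemma agree_on_vocab: "agree_on S M N \<Longrightarrow> S \<subseteq> vocab M \<Longrightarrow> S \<subseteq> vocab N"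
  by (simp add: agree_on_def vocab_subset_iff)

text \<open>Agreement compares partial values, so on \<open>vocab M\<close> it already forces
  \<open>vocab M \<subseteq> vocab N\<close>, and \<open>vocab M\<close> serves as the set of
  symbols of the reduct.\<close>

lemma expansion_of_iff: "expansion_of N M \<longleftrightarrow> agree_on (vocab M) M N"
proof
  assume "expansion_of N M"
  then show "agree_on (vocab M) M N"
    by (auto simp: expansion_of_def agree_on_def split: if_splits)
next
  assume *: "agree_on (vocab M) M N"
  then have "funs M f = funs (reduct N (vocab M)) f" "preds M p = preds (reduct N (vocab M)) p"
    for f p
    by (auto simp: agree_on_def)
  then have "M = reduct N (vocab M)"
    using * by (intro struct.equality ext) (simp_all add: agree_on_def)
  moreover have "vocab M \<subseteq> vocab N"
    using agree_on_vocab[OF *] by simp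
  ultimately show "expansion_of N M"
    unfolding expansion_of_def by blast
qed

section \<open>Coincidence: truth depends only on the occurring symbols\<close>

lemma eval_cong: "agree_on (sig_trm t) M N \<Longrightarrow> eval M A t = eval N A t"
proof (induction t)
  case (Fun f ts)
  have "eval M A t = eval N A t" if "t \<in> set ts" for t
    using Fun that by (auto intro: agree_on_mono)
  then show ?case
    using Fun.prems by (simp add: agree_on_def cong: map_cong)
next
  case (FVar g ts)
  have "eval M A t = eval N A t" if "t \<in> set ts" for t
    using FVar that by (auto intro: agree_on_mono)
  then show ?case
    by (simp cong: map_cong)
qed simp

lemma map_eval_cong:
  assumes "agree_on (\<Union>t \<in> set ts. sig_trm t) M N"
  shows "map (eval M A) ts = map (eval N A) ts"
proof (rule map_cong[OF refl])
  fix t assume "t \<in> set ts"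
  then show "eval M A t = eval N A t"
    by (intro eval_cong agree_on_mono[OF assms]) auto
qed

text \<open>Second-order quantifiers range over sets computed from \<open>carr\<close> alone, so
  equal domains give equal ranges. The assignment is generalised because quantifiers update
  it.\<close>

lemma sat_cong: "agree_on (sig_fm \<phi>) M N \<Longrightarrow> sat M A \<phi> \<longleftrightarrow> sat N A \<phi>"
proof (induction \<phi> arbitrary: A)
  case (Eq t u)
  then show ?case
    using eval_cong[of t M N A] eval_cong[of u M N A] by (simp add: agree_on_Un)
next
  case (Pred p ts)
  then have "map (eval M A) ts = map (eval N A) ts"
    by (intro map_eval_cong) (auto intro: agree_on_mono)
  moreover have "preds M p = preds N p"
    using Pred by (simp add: agree_on_def)
  ultimately show ?case by (simp del: map_eq_conv)
next
  case (PVar r ts)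
  then have "map (eval M A) ts = map (eval N A) ts"
    by (intro map_eval_cong) simp
  then show ?case by (simp del: map_eq_conv)
next
  case (And \<phi> \<psi>)
  then show ?case
    by (simp add: agree_on_Un)
next
  case (All s x \<phi>)
  then show ?case
    by (simp add: agree_on_def)
next
  case (AllF g \<phi>)
  then have "carr M = carr N" by (simp add: agree_on_def)
  then show ?case
    using AllF tuples_cong[of M N] by simp
next
  case (AllP r \<phi>)
  then have "carr M = carr N" by (simp add: agree_on_def)
  then show ?case
    using AllP tuples_cong[of M N] by simp
qed simp

lemma is_asg_cong: "carr M = carr N \<Longrightarrow> is_asg M A \<longleftrightarrow> is_asg N A"
  using tuples_cong[of M N] by (simp add: is_asg_def)

text \<open>Moves models between structures. \<open>structure N\<close> is assumed separately
  because agreement on \<open>sig T\<close> does not control the other symbols of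
  \<open>N\<close>.\<close>

lemma model_cong:
  assumes "model M T" and "structure N" and "agree_on (sig T) M N"
  shows "model N T"
proof -
  have "sat N A \<phi>" if "\<phi> \<in> T" "is_asg N A" for \<phi> A
  proof -
    have "agree_on (sig_fm \<phi>) M N"
      using assms(3) that(1) by (auto simp: sig_def intro: agree_on_mono)
    moreover have "is_asg M A"
      using is_asg_cong[of M N A] assms(3) that(2) by (simp add: agree_on_def)
    ultimately show ?thesis
      using assms(1) that(1) sat_cong[of \<phi> M N A] by (auto simp: model_def)
  qed
  moreover have "sig T \<subseteq> vocab N"
    using agree_on_vocab[OF assms(3)] assms(1) by (simp add: model_def)
  ultimately show ?thesis
    using assms(2) by (simp add: model_def)
qed

section \<open>Well-formedness of constructed structures\<close>

lemma structure_reduct: "structure M \<Longrightarrow> structure (reduct M \<tau>)"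
  using tuples_cong[of M "reduct M \<tau>"] by (simp add: structure_def)

lemma structure_patch:
  assumes "structure N" and "structure M" and "carr N = carr M"
  shows "structure (patch D N M)"
proof -
  have "tuples (patch D N M) = tuples M" "tuples N = tuples M"
    using assms(3) by (simp_all add: tuples_def fun_eq_iff)
  then show ?thesis
    using assms by (simp add: structure_def)
qed

lemma model_Un: "model M (S \<union> T) \<longleftrightarrow> model M S \<and> model M T"
  by (auto simp: model_def sig_def)

lemma model_iff_singletons:
  "model M T \<longleftrightarrow> structure M \<and> (\<forall>\<phi> \<in> T. model M {\<phi>})"
  by (auto simp: model_def sig_def)

text \<open>Needed because \<open>is_forget\<close> constrains only structures interpreting all
  symbols of the theory, the target and the result, while a model to be expanded interprets those of
  the result alone.\<close>

lemma ex_total_structure: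
  assumes "structure M"
  obtains N where "structure N" "vocab N = UNIV" "agree_on (vocab M) M N"
proof -
  \<comment> \<open>Defaults: constant functions, whose value exists because domains are nonempty,
    and empty relations.\<close>
  let ?h = "\<lambda>f. \<lambda>us \<in> tuples M (fargs f). SOME u. u \<in> carr M (fres f)"
  let ?D = "\<lparr>carr = carr M, funs = \<lambda>f. Some (?h f), preds = \<lambda>p. Some {}\<rparr>"
  let ?N = "patch (- vocab M) ?D M"
  have ne: "(SOME u. u \<in> carr M s) \<in> carr M s" for s
    using assms by (simp add: structure_def some_in_eq)
  have "structure ?D"
    using ne by (auto simp: structure_def tuples_def)
  then have "structure ?N"
    using assms by (intro structure_patch) auto
  moreover have "UNIV \<subseteq> vocab ?N"
    by (simp add: vocab_subset_iff)
  moreover have "agree_on (vocab M) M ?N"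
    by (simp add: agree_on_def)
  ultimately show ?thesis
    using that by blast
qed

section \<open>Mutual expandability and inseparability\<close>

lemma mutually_expandable_sym:
  "mutually_expandable U T1 T2 \<Longrightarrow> mutually_expandable U T2 T1"
  by (simp add: mutually_expandable_def Un_commute conj_commute)

text \<open>Frees the definition from its exact-vocabulary condition by expanding the reduct of
  \<open>M\<close> to \<open>sig T1\<close>. Hence \<open>N\<close> is tied to \<open>M\<close> on
  \<open>sig T1\<close> only.\<close>

lemma mutually_expandableD:
  fixes M :: "('s, 'n, 'u) struct"
  assumes "mutually_expandable (U :: 'u itself) T1 T2" and "model M T1"
  obtains N :: "('s, 'n, 'u) struct" where
    "model N T1" "model N T2" "agree_on (sig T1) M N"
proof -
  let ?R = "reduct M (sig T1)"
  have "vocab ?R = sig T1"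
    using assms(2) by (auto simp: model_def vocab_reduct)
  moreover have "model ?R T1"
    by (rule model_cong[OF assms(2) structure_reduct agree_on_reduct])
      (use assms(2) in \<open>simp add: model_def\<close>)
  ultimately obtain N :: "('s, 'n, 'u) struct"
    where "model N (T1 \<union> T2)" "expansion_of N ?R"
    using assms(1) by (auto simp: mutually_expandable_def)
  moreover have "agree_on (sig T1) M N"
    using agree_on_trans[OF agree_on_reduct] \<open>expansion_of N ?R\<close> \<open>vocab ?R = sig T1\<close>
    by (metis expansion_of_iff)
  ultimately show ?thesis
    using that by (auto simp: model_Un)
qed

text \<open>A model of \<open>T1\<close> is carried to a model of \<open>T2\<close>, where the
  consequence holds, and the consequence is carried back, as both structures agree on
  \<Delta>.\<close>

lemma Cons_subset_if_mutually_expandable: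
  fixes U :: "'u itself" and T1 T2 L :: "('s, 'n) fm set"
  assumes "mutually_expandable U T1 T2" and "\<Delta> \<subseteq> sig T1" and "\<Delta> \<subseteq> sig T2"
  shows "Cons U L T2 \<Delta> \<subseteq> Cons U L T1 \<Delta>"
proof
  fix \<phi> assume \<phi>: "\<phi> \<in> Cons U L T2 \<Delta>"
  then have sub: "sig_fm \<phi> \<subseteq> \<Delta>" and ent: "entails U T2 \<phi>"
    by (auto simp: Cons_def)
  have "model M {\<phi>}" if M: "model M T1" for M :: "('s, 'n, 'u) struct"
  proof -
    obtain N :: "('s, 'n, 'u) struct" where N: "model N T2" "agree_on (sig T1) M N"
      using mutually_expandableD[OF assms(1) M] by blast
    have "sig_fm \<phi> \<subseteq> vocab N"
      using N(1) sub assms(3) by (auto simp: model_def)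
    then have "model N {\<phi>}"
      using ent N(1) by (auto simp: entails_def)
    moreover have "agree_on (sig {\<phi>}) N M"
      using sub assms(2) by (intro agree_on_mono[OF agree_on_sym[OF N(2)]]) (auto simp: sig_def)
    ultimately show ?thesis
      using M by (intro model_cong[of N "{\<phi>}" M]) (simp_all add: model_def)
  qed
  then show "\<phi> \<in> Cons U L T1 \<Delta>"
    using \<phi> by (auto simp: Cons_def entails_def)
qed

section \<open>Similarity and forgetting\<close>

lemma gvals_cong:
  "agree_on (\<Union>t \<in> set ts. sig_trm t) M N \<Longrightarrow> gvals M ts = gvals N ts"
  unfolding gvals_def by (rule map_eval_cong)

lemma sim_refl: "sim \<sigma> M M"
  by (cases \<sigma>) (simp_all add: sim_def)

text \<open>Both sides receive the same values on \<open>D\<close>, so no new difference arises;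
  disjointness keeps the tuple denoted by the atom's arguments fixed. The predicate of the atom may
  itself lie in \<open>D\<close>.\<close>

lemma sim_patch:
  assumes "sim \<sigma> M M'" and "target_args \<sigma> \<inter> D = {}"
  shows "sim \<sigma> (patch D N M) (patch D N M')"
proof -
  have "agree_off \<sigma> (patch D N M) (patch D N M')"
  proof (cases \<sigma>)
    case (Atom p ts)
    have "gvals (patch D N K) ts = gvals K ts" for K
      using assms(2) Atom by (intro gvals_cong) (auto simp: agree_on_def)
    then show ?thesis
      using assms(1) Atom tuples_cong[of "patch D N M" M] by (auto simp: sim_def)
  qed simp
  then show ?thesis
    using assms(1) by (simp add: sim_def vocab_patch)
qed

text \<open>One half of (b), with one-sided conditions so that it can be applied again with the
  theories swapped.\<close>

lemma forget_expansion:
  fixes U :: "'u itself" and M0 :: "('s, 'n, 'u) struct"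
  assumes exp: "mutually_expandable U T1 T2"
    and F1: "is_forget U T1 \<sigma> F1" and F2: "is_forget U T2 \<sigma> F2"
    and sub: "sig F1 \<inter> sig T2 \<subseteq> sig T1"
    and args: "target_args \<sigma> \<inter> sig T2 \<subseteq> sig T1 \<or> equivalent U F1 T1"
    and M0: "model M0 F1" "vocab M0 = sig F1"
  shows "\<exists>N. model N (F1 \<union> F2) \<and> expansion_of N M0"
proof -
  define D where "D = sig T2 - sig T1"
  obtain M' where M': "structure M'" "vocab M' = UNIV" "agree_on (sig F1) M0 M'"
    using ex_total_structure[of M0] M0 by (auto simp: model_def)
  then have M'F1: "model M' F1"
    using model_cong M0(1) by blast
  \<comment> \<open>Either alternative makes the later patches similar: by \<open>sim_patch\<close>,
    or trivially because they coincide.\<close>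
  obtain M where M: "model M T1" "sim \<sigma> M M'" and disj: "target_args \<sigma> \<inter> D = {} \<or> M = M'"
  proof (cases "equivalent U F1 T1")
    case True
    \<comment> \<open>\<open>entails\<close> applies because the total \<open>M'\<close> interprets
      every formula.\<close>
    then have "model M' T1"
      using M'F1 M'(1,2) by (subst model_iff_singletons) (auto simp: equivalent_def entails_def)
    then show ?thesis
      using that sim_refl by blast
  next
    case False
    moreover obtain M where "model M T1" "sim \<sigma> M M'"
      using F1 M' M'F1 by (auto simp: is_forget_def)
    ultimately show ?thesis
      using that args by (auto simp: D_def)
  qed
  obtain N where N: "model N T2" "agree_on (sig T1) M N"
    using mutually_expandableD[OF exp M(1)] by blast
  have carr: "carr N = carr M" "carr M' = carr M"
    using N(2) M(2) by (auto simp: agree_on_def sim_def)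
  let ?P = "patch D N M" and ?P' = "patch D N M'"
  have sP: "structure ?P" and sP': "structure ?P'"
    using carr N(1) M(1) M'(1) by (auto intro!: structure_patch simp: model_def)
  \<comment> \<open>Symbols of \<open>T2\<close> outside \<open>D\<close> belong to
    \<open>sig T1\<close>, where \<open>M\<close> and \<open>N\<close> already agree.\<close>
  have "agree_on (sig T2) N ?P"
    using N(2) by (auto simp: agree_on_def D_def)
  then have "model ?P T2"
    using model_cong N(1) sP by blast
  moreover have "sim \<sigma> ?P ?P'"
    using disj sim_patch[OF M(2)] sim_refl by auto
  moreover have "D \<subseteq> vocab N"
    using N(1) by (auto simp: D_def model_def)
  \<comment> \<open>Patching loses no symbol, so \<open>is_forget\<close> for \<open>T2\<close>
    covers \<open>?P'\<close>.\<close>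
  then have "UNIV \<subseteq> vocab ?P'"
    using M'(2) by (auto simp: vocab_patch)
  ultimately have "model ?P' F2"
    using F2 sP' unfolding is_forget_def by blast
  \<comment> \<open>By \<open>sub\<close>, no symbol of \<open>F1\<close> lies in
    \<open>D\<close>.\<close>
  moreover have agree: "agree_on (sig F1) M0 ?P'"
    using M'(3) sub by (auto simp: agree_on_def D_def)
  then have "model ?P' F1"
    using model_cong M0(1) sP' by blast
  ultimately show ?thesis
    using agree M0(2) by (auto simp: model_Un expansion_of_iff)
qed

text \<open>The bounds on \<open>sig F1\<close> and \<open>sig F2\<close> exclude results that
  mention a symbol private to the other theory, even in a tautology: their models could fix it
  unsuitably.\<close>

theorem proposition3p8:
  fixes U :: "'u itself"
    and L T1 T2 :: "('s, 'n) fm set"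
    and \<Delta> :: "('s, 'n) sym set"
  assumes "\<forall>\<phi> \<in> L. sentence \<phi>"
    and "T1 \<subseteq> L" and "T2 \<subseteq> L"
    and "sig T1 \<inter> sig T2 = \<Delta>"
    and "mutually_expandable U T1 T2"
  shows "inseparable U L \<Delta> T1 T2 \<and>
    (\<forall>\<sigma> F1 F2.
       wf_target \<sigma> \<and> is_forget U T1 \<sigma> F1 \<and> is_forget U T2 \<sigma> F2 \<and>
       sig F1 \<inter> sig T2 \<subseteq> \<Delta> \<and> sig F2 \<inter> sig T1 \<subseteq> \<Delta> \<and>
       (target_args \<sigma> \<inter> sig T2 \<subseteq> \<Delta> \<or> equivalent U F1 T1) \<and>
       (target_args \<sigma> \<inter> sig T1 \<subseteq> \<Delta> \<or> equivalent U F2 T2) \<longrightarrow>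
       mutually_expandable U F1 F2)"
proof (intro conjI allI impI)
  have \<Delta>: "\<Delta> \<subseteq> sig T1" "\<Delta> \<subseteq> sig T2"
    using assms(4) by auto
  note exp = assms(5) and exp' = mutually_expandable_sym[OF assms(5)]
  show "inseparable U L \<Delta> T1 T2"
    unfolding inseparable_def
    using Cons_subset_if_mutually_expandable[OF exp \<Delta>]
      Cons_subset_if_mutually_expandable[OF exp' \<Delta>(2,1)] by (rule equalityI[rotated])
  fix \<sigma> F1 F2
  assume *: "wf_target \<sigma> \<and> is_forget U T1 \<sigma> F1 \<and> is_forget U T2 \<sigma> F2 \<and>
    sig F1 \<inter> sig T2 \<subseteq> \<Delta> \<and> sig F2 \<inter> sig T1 \<subseteq> \<Delta> \<and>
    (target_args \<sigma> \<inter> sig T2 \<subseteq> \<Delta> \<or> equivalent U F1 T1) \<and>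
    (target_args \<sigma> \<inter> sig T1 \<subseteq> \<Delta> \<or> equivalent U F2 T2)"
  have "\<exists>N. model N (F1 \<union> F2) \<and> expansion_of N M"
    if "model M F1" "vocab M = sig F1" for M :: "('s, 'n, 'u) struct"
    using * \<Delta> that by (intro forget_expansion[OF exp]) auto
  moreover have "\<exists>N. model N (F2 \<union> F1) \<and> expansion_of N M"
    if "model M F2" "vocab M = sig F2" for M :: "('s, 'n, 'u) struct"
    using * \<Delta> that by (intro forget_expansion[OF exp']) auto
  ultimately show "mutually_expandable U F1 F2"
    by (auto simp: mutually_expandable_def Un_commute)
qed

end
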